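(* Let $R$ be a commutative ring with $1\neq 0$ and let $S$ be a multiplicatively closed subset of $R$. The map $P\mapsto\Lambda(P)$ is a bijection between $\mathrm{Spec}\,S^{-1}R$ (identified with the set of prime ideals of $R$ disjoint from $S$) and the set of irreducible closed subsets of $\mathrm{Spec}_SR$ with respect to the $S$-flat topology. Moreover, under this correspondence, the set of maximal ideals of $S^{-1}R$ is in bijection with the set of irreducible components of $\mathrm{Spec}_SR$ for the $S$-flat topology.
   Context: A multiplicatively closed subset $S$ of $R$ satisfies $0\notin S$, $1\in S$, and $ss'\in S$ for all $s,s'\in S$. An ideal $P$ of $R$ is $S$-prime if $P\cap S=\emptyset$ and there exists $s\in S$ such that for all $a,b\in R$, $ab\in P$ implies $sa\in P$ or $sb\in P$. $\mathrm{Spec}_SR$ is the set of all $S$-prime ideals of $R$; every prime ideal disjoint from $S$ belongs to it. For $f\in R$, $V_S(f)=\{P\in\mathrm{Spec}_SR : sf\in P \text{ for some } s\in S\}$. The $S$-flat topology on $\mathrm{Spec}_SR$ is the topology having the sets $V_S(f)$, $f\in R$, as a sub-basis of open sets. For $P\in\mathrm{Spec}_SR$, $\Lambda(P)$ denotes the closure of $\{P\}$ in the $S$-flat topology. Irreducible sets are nonempty by convention. *)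

theory Defs
  imports "HOL-Analysis.Abstract_Topology" "HOL-Algebra.Ideal"
begin

section \<open>Localizations and prime spectra\<close>

definition mult_closed :: "('a, 'm) ring_scheme \<Rightarrow> 'a set \<Rightarrow> bool" where
  "mult_closed R S \<longleftrightarrow> S \<subseteq> carrier R \<and> \<zero>\<^bsub>R\<^esub> \<notin> S \<and> \<one>\<^bsub>R\<^esub> \<in> S \<and>
     (\<forall>s\<in>S. \<forall>t\<in>S. s \<otimes>\<^bsub>R\<^esub> t \<in> S)"

definition frac_rel :: "('a, 'm) ring_scheme \<Rightarrow> 'a set \<Rightarrow> (('a \<times> 'a) \<times> ('a \<times> 'a)) set" where
  "frac_rel R S = {((a, s), (b, t)). a \<in> carrier R \<and> s \<in> S \<and> b \<in> carrier R \<and> t \<in> S \<and>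
     (\<exists>u\<in>S. u \<otimes>\<^bsub>R\<^esub> (a \<otimes>\<^bsub>R\<^esub> t \<ominus>\<^bsub>R\<^esub> b \<otimes>\<^bsub>R\<^esub> s) = \<zero>\<^bsub>R\<^esub>)}"

definition fraction :: "('a, 'm) ring_scheme \<Rightarrow> 'a set \<Rightarrow> 'a \<Rightarrow> 'a \<Rightarrow> ('a \<times> 'a) set" where
  "fraction R S a s = frac_rel R S `` {(a, s)}"

text \<open>The ring of fractions. The operations on classes are the unions of the
  results over all representatives; since the results do not depend on the
  representatives, all members of such a union coincide.\<close>

definition localization :: "('a, 'm) ring_scheme \<Rightarrow> 'a set \<Rightarrow> ('a \<times> 'a) set ring" where
  "localization R S =
    \<lparr>carrier = (carrier R \<times> S) // frac_rel R S,
     monoid.mult = (\<lambda>X Y. \<Union>(a, s)\<in>X. \<Union>(b, t)\<in>Y. fraction R S (a \<otimes>\<^bsub>R\<^esub> b) (s \<otimes>\<^bsub>R\<^esub> t)),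
     one = fraction R S \<one>\<^bsub>R\<^esub> \<one>\<^bsub>R\<^esub>,
     zero = fraction R S \<zero>\<^bsub>R\<^esub> \<one>\<^bsub>R\<^esub>,
     add = (\<lambda>X Y. \<Union>(a, s)\<in>X. \<Union>(b, t)\<in>Y.
       fraction R S (a \<otimes>\<^bsub>R\<^esub> t \<oplus>\<^bsub>R\<^esub> b \<otimes>\<^bsub>R\<^esub> s) (s \<otimes>\<^bsub>R\<^esub> t))\<rparr>"

text \<open>The preimage of a subset of the localization under the canonical map
  \<open>a \<mapsto> a / 1\<close>; on prime ideals it is the usual identification of the spectrum
  of the localization with the primes disjoint from \<open>S\<close>.\<close>

definition contraction :: "('a, 'm) ring_scheme \<Rightarrow> 'a set \<Rightarrow> ('a \<times> 'a) set set \<Rightarrow> 'a set" where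
  "contraction R S Q = {a \<in> carrier R. fraction R S a \<one>\<^bsub>R\<^esub> \<in> Q}"

definition Spec :: "('a, 'm) ring_scheme \<Rightarrow> 'a set set" where
  "Spec R = {P. primeideal P R}"

definition Max_Spec :: "('a, 'm) ring_scheme \<Rightarrow> 'a set set" where
  "Max_Spec R = {M. maximalideal M R}"

definition disjoint_primes :: "('a, 'm) ring_scheme \<Rightarrow> 'a set \<Rightarrow> 'a set set" where
  "disjoint_primes R S = {P \<in> Spec R. P \<inter> S = {}}"


section \<open>The \<open>S\<close>-flat topology\<close>

definition S_prime :: "('a, 'm) ring_scheme \<Rightarrow> 'a set \<Rightarrow> 'a set \<Rightarrow> bool" where
  "S_prime R S P \<longleftrightarrow> ideal P R \<and> P \<inter> S = {} \<and>
     (\<exists>s\<in>S. \<forall>a\<in>carrier R. \<forall>b\<in>carrier R.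
        a \<otimes>\<^bsub>R\<^esub> b \<in> P \<longrightarrow> s \<otimes>\<^bsub>R\<^esub> a \<in> P \<or> s \<otimes>\<^bsub>R\<^esub> b \<in> P)"

definition S_Spec :: "('a, 'm) ring_scheme \<Rightarrow> 'a set \<Rightarrow> 'a set set" where
  "S_Spec R S = {P. S_prime R S P}"

definition S_V :: "('a, 'm) ring_scheme \<Rightarrow> 'a set \<Rightarrow> 'a \<Rightarrow> 'a set set" where
  "S_V R S f = {P \<in> S_Spec R S. \<exists>s\<in>S. s \<otimes>\<^bsub>R\<^esub> f \<in> P}"

text \<open>The underlying space of \<^const>\<open>topology_generated_by\<close> is the union of the
  sub-basis, which is all of \<open>S_Spec R S\<close> because \<open>S_V R S \<zero> = S_Spec R S\<close>.\<close>

definition S_flat :: "('a, 'm) ring_scheme \<Rightarrow> 'a set \<Rightarrow> 'a set topology" where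
  "S_flat R S = topology_generated_by (S_V R S ` carrier R)"

definition Lambda :: "('a, 'm) ring_scheme \<Rightarrow> 'a set \<Rightarrow> 'a set \<Rightarrow> 'a set set" where
  "Lambda R S P = S_flat R S closure_of {P}"


section \<open>Irreducible sets and components\<close>

definition irreducible_in :: "'a topology \<Rightarrow> 'a set \<Rightarrow> bool" where
  "irreducible_in X A \<longleftrightarrow> A \<subseteq> topspace X \<and> A \<noteq> {} \<and>
     (\<forall>C D. closedin (subtopology X A) C \<and> closedin (subtopology X A) D \<and> A = C \<union> D
        \<longrightarrow> C = A \<or> D = A)"

definition irreducible_closed :: "'a topology \<Rightarrow> 'a set set" where
  "irreducible_closed X = {A. irreducible_in X A \<and> closedin X A}"

definition irreducible_components :: "'a topology \<Rightarrow> 'a set set" where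
  "irreducible_components X =
     {A. irreducible_in X A \<and> (\<forall>B. irreducible_in X B \<and> A \<subseteq> B \<longrightarrow> B = A)}"

end

theory Submission
  imports Defs
begin

text \<open>
  The key to the argument is that the \<open>S\<close>-flat topology does not see an \<open>S\<close>-prime ideal \<open>P\<close>
  itself but only its saturation \<open>{f. s f \<in> P for some s \<in> S}\<close>: the sub-basic open set
  \<open>V(f)\<close> consists of the \<open>P\<close> whose saturation contains \<open>f\<close>. The saturation is an honest prime
  ideal disjoint from \<open>S\<close>, and primes disjoint from \<open>S\<close> are their own saturations. Hence
  \<open>\<Lambda>(P)\<close> is the set of all \<open>Q\<close> whose saturation lies in that of \<open>P\<close> (\<open>Lambda_eq\<close>), and on
  primes disjoint from \<open>S\<close> the map \<open>\<Lambda>\<close> preserves and reflects inclusion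
  (\<open>Lambda_subset_iff\<close>); in particular it is injective there.

  For surjectivity, let \<open>Z\<close> be irreducible and closed and let \<open>p\<close> be the union of the saturations
  of its members, that is, the set of the \<open>f\<close> for which \<open>V(f)\<close> meets \<open>Z\<close>. A union of primes is
  seldom closed under addition; here it is, because two open sets that meet an irreducible set
  meet it in a common point, so that any \<open>f\<close> and \<open>g\<close> in \<open>p\<close> lie in one and the same
  saturation (\<open>generic_prime_of_irreducible\<close>). The same property shows that every open
  neighbourhood of \<open>p\<close> meets \<open>Z\<close>, so \<open>p \<in> Z\<close> since \<open>Z\<close> is closed
  (\<open>generic_prime_mem_closed\<close>), and \<open>Z = \<Lambda>(p)\<close> follows.

  Contraction is an isomorphism of ordered sets from the primes of the ring of fractions onto the
  primes disjoint from \<open>S\<close>, because an ideal of fractions contains \<open>a / s\<close> exactly when it contains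
  \<open>a / 1\<close>. The composite of the two bijections is therefore an order isomorphism from the spectrum
  of the ring of fractions to the irreducible closed sets, and it matches the maximal elements on
  both sides. These are the maximal ideals (\<open>Max_Spec_iff_maximal_in_Spec\<close>, by Zorn's lemma) and
  the irreducible components (\<open>irreducible_components_iff_maximal_closed\<close>).
\<close>


section \<open>Irreducible sets in a topological space\<close>

text \<open>A decomposition of the closure into closed pieces restricts to one of \<open>A\<close>; a piece
  containing \<open>A\<close> contains its closure.\<close>

lemma irreducible_in_closure_of:
  assumes "irreducible_in X A"
  shows "irreducible_in X (X closure_of A)"
  unfolding irreducible_in_def
proof (intro conjI allI impI)
  have A: "A \<subseteq> topspace X" "A \<noteq> {}"
    using assms by (auto simp: irreducible_in_def)
  then have sub: "A \<subseteq> X closure_of A"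
    by (simp add: closure_of_subset)
  show "X closure_of A \<subseteq> topspace X" by (rule closure_of_subset_topspace)
  show "X closure_of A \<noteq> {}" using A sub by blast
  fix C D
  assume CD: "closedin (subtopology X (X closure_of A)) C \<and>
    closedin (subtopology X (X closure_of A)) D \<and> X closure_of A = C \<union> D"
  then have cl: "closedin X C" "closedin X D"
    using closedin_closed_subtopology[OF closedin_closure_of] by blast+
  then have "closedin (subtopology X A) (C \<inter> A)" "closedin (subtopology X A) (D \<inter> A)"
    by (auto simp: closedin_subtopology)
  moreover have "A = C \<inter> A \<union> D \<inter> A" using CD sub by blast
  ultimately have "C \<inter> A = A \<or> D \<inter> A = A"
    using assms unfolding irreducible_in_def by blast
  then have "X closure_of A \<subseteq> C \<or> X closure_of A \<subseteq> D"
    using cl by (metis closure_of_minimal inf.absorb_iff2)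
  then show "C = X closure_of A \<or> D = X closure_of A" using CD by blast
qed

lemma irreducible_in_closure_of_point:
  assumes "x \<in> topspace X"
  shows "irreducible_in X (X closure_of {x})"
proof (rule irreducible_in_closure_of)
  show "irreducible_in X {x}"
    using assms unfolding irreducible_in_def by blast
qed

text \<open>Irreducibility in terms of open sets: if \<open>U\<close> and \<open>V\<close> had no common point in \<open>A\<close>,
  then \<open>A\<close> would be the union of the proper closed subsets \<open>A - U\<close> and \<open>A - V\<close>.\<close>

lemma irreducible_in_open_Int_nonempty:
  assumes irr: "irreducible_in X A" and U: "openin X U" and V: "openin X V"
    and "A \<inter> U \<noteq> {}" and "A \<inter> V \<noteq> {}"
  shows "A \<inter> (U \<inter> V) \<noteq> {}"
proof
  assume empty: "A \<inter> (U \<inter> V) = {}"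
  have A: "A \<subseteq> topspace X" using irr by (simp add: irreducible_in_def)
  have "closedin (subtopology X A) (A - W)" if "openin X W" for W
    unfolding closedin_subtopology
    by (rule exI[of _ "topspace X - W"]) (use A that in auto)
  moreover have "A = (A - U) \<union> (A - V)" using empty by blast
  ultimately have "A - U = A \<or> A - V = A"
    using irr U V unfolding irreducible_in_def by blast
  then show False using assms(4,5) by blast
qed

text \<open>Passing to the closure keeps a set irreducible, so maximality may be tested on closed
  sets alone.\<close>

lemma irreducible_components_iff_maximal_closed:
  "A \<in> irreducible_components X \<longleftrightarrow>
    A \<in> irreducible_closed X \<and> (\<forall>B\<in>irreducible_closed X. A \<subseteq> B \<longrightarrow> B = A)"
proof
  assume A: "A \<in> irreducible_components X"
  then have irr: "irreducible_in X A"
    and max: "\<And>B. irreducible_in X B \<Longrightarrow> A \<subseteq> B \<Longrightarrow> B = A"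
    by (auto simp: irreducible_components_def)
  have "A \<subseteq> X closure_of A"
    using irr by (simp add: irreducible_in_def closure_of_subset)
  then have "X closure_of A = A"
    using max irreducible_in_closure_of[OF irr] by blast
  then have "closedin X A" by (simp add: closure_of_eq)
  then show "A \<in> irreducible_closed X \<and> (\<forall>B\<in>irreducible_closed X. A \<subseteq> B \<longrightarrow> B = A)"
    using irr max by (auto simp: irreducible_closed_def)
next
  assume A: "A \<in> irreducible_closed X \<and> (\<forall>B\<in>irreducible_closed X. A \<subseteq> B \<longrightarrow> B = A)"
  show "A \<in> irreducible_components X"
    unfolding irreducible_components_def
  proof (intro CollectI conjI allI impI)
    show "irreducible_in X A" using A by (simp add: irreducible_closed_def)
    fix B assume B: "irreducible_in X B \<and> A \<subseteq> B"
    then have "B \<subseteq> X closure_of B"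
      by (simp add: irreducible_in_def closure_of_subset)
    moreover have "X closure_of B \<in> irreducible_closed X"
      using B by (simp add: irreducible_closed_def irreducible_in_closure_of)
    ultimately have "X closure_of B = A" using A B by blast
    then show "B = A" using B \<open>B \<subseteq> X closure_of B\<close> by blast
  qed
qed


section \<open>Ideals of a commutative ring\<close>

text \<open>Closure under negation comes for free from multiplication by \<open>\<ominus> \<one>\<close>.\<close>

lemma (in cring) idealI_of_closed:
  assumes sub: "I \<subseteq> carrier R" and zero: "\<zero> \<in> I"
    and add: "\<And>a b. a \<in> I \<Longrightarrow> b \<in> I \<Longrightarrow> a \<oplus> b \<in> I"
    and mult: "\<And>a x. a \<in> I \<Longrightarrow> x \<in> carrier R \<Longrightarrow> x \<otimes> a \<in> I"
  shows "ideal I R"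
proof (rule idealI)
  show "ring R" by (rule ring_axioms)
  show "subgroup I (add_monoid R)"
  proof (rule add.subgroupI)
    fix a assume a: "a \<in> I"
    then have "\<ominus> a = (\<ominus> \<one>) \<otimes> a" using sub by (auto simp: l_minus)
    then show "\<ominus> a \<in> I" using mult[OF a] by simp
  qed (use sub zero add in auto)
  show "x \<otimes> a \<in> I" if "a \<in> I" "x \<in> carrier R" for a x
    using mult that by blast
  show "a \<otimes> x \<in> I" if "a \<in> I" "x \<in> carrier R" for a x
    using mult[OF that] that sub m_comm[of a x] by auto
qed

text \<open>Zorn's lemma applies because properness means \<open>\<one> \<notin> J\<close>, a condition that passes to
  unions of chains.\<close>

lemma (in cring) exists_maximalideal_containing:
  assumes I: "ideal I R" and proper: "I \<noteq> carrier R"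
  shows "\<exists>M. maximalideal M R \<and> I \<subseteq> M"
proof -
  define A where "A = {J. ideal J R \<and> I \<subseteq> J \<and> \<one> \<notin> J}"
  have carr: "J \<subseteq> carrier R" if "ideal J R" for J
    using that by (rule additive_subgroup.a_subset[OF ideal.axioms(1)])
  have "I \<in> A"
    using I proper ideal.one_imp_carrier[OF I] by (auto simp: A_def)
  then have "A \<noteq> {}" by blast
  then have "\<exists>M\<in>A. \<forall>X\<in>A. M \<subseteq> X \<longrightarrow> X = M"
  proof (rule subset_Zorn_nonempty)
    fix C assume nonempty: "C \<noteq> {}" and chain: "subset.chain A C"
    then have CA: "\<And>J. J \<in> C \<Longrightarrow> J \<in> A"
      and tot: "\<And>J K. J \<in> C \<Longrightarrow> K \<in> C \<Longrightarrow> J \<subseteq> K \<or> K \<subseteq> J"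
      unfolding subset.chain_def by blast+
    have "ideal (\<Union>C) R"
    proof (rule idealI_of_closed)
      show "\<Union>C \<subseteq> carrier R" using CA carr by (auto simp: A_def)
      obtain J where "J \<in> C" using nonempty by blast
      then have "\<zero> \<in> J"
        using CA additive_subgroup.zero_closed[OF ideal.axioms(1)] by (auto simp: A_def)
      then show "\<zero> \<in> \<Union>C" using \<open>J \<in> C\<close> by blast
    next
      fix a b assume "a \<in> \<Union>C" "b \<in> \<Union>C"
      then obtain K L where "K \<in> C" "a \<in> K" "L \<in> C" "b \<in> L" by blast
      then obtain J where J: "J \<in> C" "a \<in> J" "b \<in> J" using tot[of K L] by blast
      then interpret J: ideal J R using CA[OF J(1)] by (simp add: A_def)
      show "a \<oplus> b \<in> \<Union>C" using J J.a_closed by blast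
    next
      fix a x assume "a \<in> \<Union>C" and x: "x \<in> carrier R"
      then obtain J where J: "J \<in> C" "a \<in> J" by blast
      interpret J: ideal J R using CA[OF J(1)] by (simp add: A_def)
      show "x \<otimes> a \<in> \<Union>C" using J J.I_l_closed[OF _ x] by blast
    qed
    moreover have "I \<subseteq> \<Union>C"
    proof -
      obtain J where "J \<in> C" using nonempty by blast
      then show ?thesis using CA[of J] by (auto simp: A_def)
    qed
    moreover have "\<one> \<notin> \<Union>C" using CA by (auto simp: A_def)
    ultimately show "\<Union>C \<in> A" by (simp add: A_def)
  qed
  then obtain M where "M \<in> A" and max: "\<And>J. J \<in> A \<Longrightarrow> M \<subseteq> J \<Longrightarrow> J = M"
    by blast
  then have M: "ideal M R" "I \<subseteq> M" "\<one> \<notin> M" by (auto simp: A_def)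
  have "maximalideal M R"
  proof (rule maximalidealI[OF M(1)])
    show "carrier R \<noteq> M" using M(3) by auto
    fix J assume J: "ideal J R" "M \<subseteq> J"
    show "J = M \<or> J = carrier R"
    proof (cases "\<one> \<in> J")
      case True
      then show ?thesis using ideal.one_imp_carrier[OF J(1)] by blast
    next
      case False
      then have "J \<in> A" using J M(2) by (auto simp: A_def)
      then show ?thesis using max J(2) by blast
    qed
  qed
  then show ?thesis using M(2) by blast
qed

text \<open>This reduces maximality to the order on the spectrum, which is all that contraction and
  \<open>\<Lambda>\<close> can transport: a maximal ideal above a maximal prime is itself prime, hence equal to it.\<close>

lemma (in cring) Max_Spec_iff_maximal_in_Spec:
  "M \<in> Max_Spec R \<longleftrightarrow> M \<in> Spec R \<and> (\<forall>P\<in>Spec R. M \<subseteq> P \<longrightarrow> P = M)"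
proof
  assume "M \<in> Max_Spec R"
  then have M: "maximalideal M R" by (simp add: Max_Spec_def)
  have "P = M" if "primeideal P R" "M \<subseteq> P" for P
  proof -
    interpret P: primeideal P R by fact
    show ?thesis
      using maximalideal.I_maximal[OF M P.is_ideal that(2) P.a_subset] P.I_notcarr by blast
  qed
  then show "M \<in> Spec R \<and> (\<forall>P\<in>Spec R. M \<subseteq> P \<longrightarrow> P = M)"
    using maximalideal_prime[OF M] by (auto simp: Spec_def)
next
  assume M: "M \<in> Spec R \<and> (\<forall>P\<in>Spec R. M \<subseteq> P \<longrightarrow> P = M)"
  then interpret M: primeideal M R by (simp add: Spec_def)
  obtain N where N: "maximalideal N R" "M \<subseteq> N"
    using exists_maximalideal_containing[OF M.is_ideal] M.I_notcarr by blast
  then have "N = M" using M maximalideal_prime[OF N(1)] by (simp add: Spec_def)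
  then show "M \<in> Max_Spec R" using N(1) by (simp add: Max_Spec_def)
qed


section \<open>The ring of fractions\<close>

locale cring_mult_closed = cring R for R (structure) +
  fixes S
  assumes mult_closed: "mult_closed R S"
begin

lemma S_carrier [simp]: "s \<in> S \<Longrightarrow> s \<in> carrier R"
  and one_in_S [simp, intro]: "\<one> \<in> S"
  and S_mult [simp]: "s \<in> S \<Longrightarrow> t \<in> S \<Longrightarrow> s \<otimes> t \<in> S"
  using mult_closed unfolding mult_closed_def by auto

text \<open>Cross-multiplied form of the relation, in which calculations need no subtraction.\<close>

lemma frac_rel_iff:
  "((a, s), (b, t)) \<in> frac_rel R S \<longleftrightarrow> a \<in> carrier R \<and> s \<in> S \<and> b \<in> carrier R \<and> t \<in> S \<and>
    (\<exists>u\<in>S. u \<otimes> (a \<otimes> t) = u \<otimes> (b \<otimes> s))"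
proof -
  have eq: "u \<otimes> (x \<ominus> y) = \<zero> \<longleftrightarrow> u \<otimes> x = u \<otimes> y"
    if "u \<in> carrier R" "x \<in> carrier R" "y \<in> carrier R" for u x y
  proof -
    have "u \<otimes> (x \<ominus> y) = u \<otimes> x \<ominus> u \<otimes> y"
      using that by (simp add: a_minus_def r_distr r_minus)
    then show ?thesis
      using that add.inv_solve_right'[of "\<zero>" "u \<otimes> x" "u \<otimes> y"] by (simp add: a_minus_def)
  qed
  show ?thesis unfolding frac_rel_def by (auto simp: eq cong: conj_cong bex_cong)
qed

lemma equiv_frac_rel: "equiv (carrier R \<times> S) (frac_rel R S)"
proof (rule equivI)
  show "frac_rel R S \<subseteq> (carrier R \<times> S) \<times> (carrier R \<times> S)"
    by (auto simp: frac_rel_iff)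
  show "refl_on (carrier R \<times> S) (frac_rel R S)"
    by (auto simp: refl_on_def frac_rel_iff)
  show "sym (frac_rel R S)"
    by (auto simp: sym_def frac_rel_iff) metis
  show "trans (frac_rel R S)"
  proof (rule transI, clarify)
    fix a s b t c w
    assume 1: "((a, s), (b, t)) \<in> frac_rel R S" and 2: "((b, t), (c, w)) \<in> frac_rel R S"
    then have carr: "a \<in> carrier R" "b \<in> carrier R" "c \<in> carrier R" "s \<in> S" "t \<in> S" "w \<in> S"
      by (auto simp: frac_rel_iff)
    obtain u v where u: "u \<in> S" "u \<otimes> (a \<otimes> t) = u \<otimes> (b \<otimes> s)"
      and v: "v \<in> S" "v \<otimes> (b \<otimes> w) = v \<otimes> (c \<otimes> t)"
      using 1 2 by (auto simp: frac_rel_iff)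
    \<comment> \<open>The middle denominator \<open>t\<close> is not cancellable and becomes part of the witness.\<close>
    have "(u \<otimes> v \<otimes> t) \<otimes> (a \<otimes> w) = (v \<otimes> w) \<otimes> (u \<otimes> (a \<otimes> t))"
      using carr u(1) v(1) by (simp add: m_ac)
    also have "\<dots> = (u \<otimes> s) \<otimes> (v \<otimes> (b \<otimes> w))"
      unfolding u using carr u(1) v(1) by (simp add: m_ac)
    also have "\<dots> = (u \<otimes> v \<otimes> t) \<otimes> (c \<otimes> s)"
      unfolding v using carr u(1) v(1) by (simp add: m_ac)
    finally have "(u \<otimes> v \<otimes> t) \<otimes> (a \<otimes> w) = (u \<otimes> v \<otimes> t) \<otimes> (c \<otimes> s)" .
    moreover have "u \<otimes> v \<otimes> t \<in> S" using carr u(1) v(1) by simp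
    ultimately show "((a, s), (c, w)) \<in> frac_rel R S"
      unfolding frac_rel_iff using carr by blast
  qed
qed

lemma fraction_eq_iff:
  assumes "a \<in> carrier R" "s \<in> S" "b \<in> carrier R" "t \<in> S"
  shows "fraction R S a s = fraction R S b t \<longleftrightarrow> (\<exists>u\<in>S. u \<otimes> (a \<otimes> t) = u \<otimes> (b \<otimes> s))"
  unfolding fraction_def using assms
  by (simp add: eq_equiv_class_iff[OF equiv_frac_rel] frac_rel_iff)

lemma fraction_eq_witness:
  assumes "u \<in> S" and "u \<otimes> (a \<otimes> t) = u \<otimes> (b \<otimes> s)"
    and "a \<in> carrier R" "s \<in> S" "b \<in> carrier R" "t \<in> S"
  shows "fraction R S a s = fraction R S b t"
  unfolding fraction_eq_iff[OF assms(3-6)] using assms(1,2) by blast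

lemma fraction_eqI:
  assumes "a \<in> carrier R" "s \<in> S" "b \<in> carrier R" "t \<in> S" and "a \<otimes> t = b \<otimes> s"
  shows "fraction R S a s = fraction R S b t"
  by (rule fraction_eq_witness[of \<one>]) (use assms in auto)

lemma mem_fraction_iff:
  assumes "a \<in> carrier R" "s \<in> S"
  shows "(b, t) \<in> fraction R S a s \<longleftrightarrow>
    b \<in> carrier R \<and> t \<in> S \<and> fraction R S b t = fraction R S a s"
  using equiv_class_eq_iff[OF equiv_frac_rel, of "(a, s)" "(b, t)"] assms
  unfolding fraction_def mem_Sigma_iff Image_singleton_iff by blast

lemma carrier_localization:
  "carrier (localization R S) = {fraction R S a s | a s. a \<in> carrier R \<and> s \<in> S}"
  by (auto simp: localization_def quotient_def fraction_def)

lemma localization_cases: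
  assumes "X \<in> carrier (localization R S)"
  obtains a s where "X = fraction R S a s" "a \<in> carrier R" "s \<in> S"
  using assms unfolding carrier_localization by blast

lemma fraction_in_carrier [simp, intro]:
  "a \<in> carrier R \<Longrightarrow> s \<in> S \<Longrightarrow> fraction R S a s \<in> carrier (localization R S)"
  by (auto simp: carrier_localization)

lemma zero_localization: "\<zero>\<^bsub>localization R S\<^esub> = fraction R S \<zero> \<one>"
  and one_localization: "\<one>\<^bsub>localization R S\<^esub> = fraction R S \<one> \<one>"
  by (simp_all add: localization_def)

lemma fraction_zero: "s \<in> S \<Longrightarrow> fraction R S \<zero> s = fraction R S \<zero> \<one>"
  by (rule fraction_eqI) simp_all

lemma fraction_self: "s \<in> S \<Longrightarrow> fraction R S s s = fraction R S \<one> \<one>"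
  by (rule fraction_eqI) simp_all

text \<open>Evaluates the unions over all representatives by which the ring operations on fractions are
  defined, once their independence of the representatives is known.\<close>

lemma UN_fraction2:
  assumes carr: "a \<in> carrier R" "s \<in> S" "b \<in> carrier R" "t \<in> S"
    and const: "\<And>a' s' b' t'. \<lbrakk>a' \<in> carrier R; s' \<in> S; b' \<in> carrier R; t' \<in> S;
      fraction R S a' s' = fraction R S a s; fraction R S b' t' = fraction R S b t\<rbrakk>
      \<Longrightarrow> F a' s' b' t' = F a s b t"
  shows "(\<Union>(a', s')\<in>fraction R S a s. \<Union>(b', t')\<in>fraction R S b t. F a' s' b' t') = F a s b t"
proof -
  have ne: "fraction R S a s \<noteq> {}" "fraction R S b t \<noteq> {}"
    using mem_fraction_iff[OF carr(1,2), of a s] mem_fraction_iff[OF carr(3,4), of b t] carr by auto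
  have eq: "F (fst x) (snd x) (fst y) (snd y) = F a s b t"
    if "x \<in> fraction R S a s" "y \<in> fraction R S b t" for x y
  proof (rule const)
    show "fst x \<in> carrier R" "snd x \<in> S" "fraction R S (fst x) (snd x) = fraction R S a s"
      using that(1) mem_fraction_iff[OF carr(1,2), of "fst x" "snd x"] by auto
    show "fst y \<in> carrier R" "snd y \<in> S" "fraction R S (fst y) (snd y) = fraction R S b t"
      using that(2) mem_fraction_iff[OF carr(3,4), of "fst y" "snd y"] by auto
  qed
  have "(\<Union>(a', s')\<in>fraction R S a s. \<Union>(b', t')\<in>fraction R S b t. F a' s' b' t') =
      (\<Union>x\<in>fraction R S a s. \<Union>y\<in>fraction R S b t. F a s b t)"
    unfolding split_beta by (intro SUP_cong refl eq)
  then show ?thesis using ne by simp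
qed

lemma mult_fraction:
  assumes carr: "a \<in> carrier R" "s \<in> S" "b \<in> carrier R" "t \<in> S"
  shows "fraction R S a s \<otimes>\<^bsub>localization R S\<^esub> fraction R S b t = fraction R S (a \<otimes> b) (s \<otimes> t)"
proof -
  have "fraction R S (a' \<otimes> b') (s' \<otimes> t') = fraction R S (a \<otimes> b) (s \<otimes> t)"
    if carr': "a' \<in> carrier R" "s' \<in> S" "b' \<in> carrier R" "t' \<in> S"
      and eqs: "fraction R S a' s' = fraction R S a s" "fraction R S b' t' = fraction R S b t"
    for a' s' b' t'
  proof -
    obtain u where u: "u \<in> S" "u \<otimes> (a' \<otimes> s) = u \<otimes> (a \<otimes> s')"
      using eqs(1) fraction_eq_iff[OF carr'(1,2) carr(1,2)] by blast
    obtain v where v: "v \<in> S" "v \<otimes> (b' \<otimes> t) = v \<otimes> (b \<otimes> t')"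
      using eqs(2) fraction_eq_iff[OF carr'(3,4) carr(3,4)] by blast
    have "(u \<otimes> v) \<otimes> ((a' \<otimes> b') \<otimes> (s \<otimes> t)) = (u \<otimes> (a' \<otimes> s)) \<otimes> (v \<otimes> (b' \<otimes> t))"
      using carr carr' u(1) v(1) by (simp add: m_ac)
    also have "\<dots> = (u \<otimes> v) \<otimes> ((a \<otimes> b) \<otimes> (s' \<otimes> t'))"
      unfolding u v using carr carr' u(1) v(1) by (simp add: m_ac)
    finally show ?thesis
      by (rule fraction_eq_witness[rotated]) (use carr carr' u(1) v(1) in simp_all)
  qed
  then have "(\<Union>(a', s')\<in>fraction R S a s. \<Union>(b', t')\<in>fraction R S b t.
      fraction R S (a' \<otimes> b') (s' \<otimes> t')) = fraction R S (a \<otimes> b) (s \<otimes> t)"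
    by (rule UN_fraction2[OF carr])
  then show ?thesis by (simp add: localization_def)
qed

lemma add_fraction:
  assumes carr: "a \<in> carrier R" "s \<in> S" "b \<in> carrier R" "t \<in> S"
  shows "fraction R S a s \<oplus>\<^bsub>localization R S\<^esub> fraction R S b t =
    fraction R S (a \<otimes> t \<oplus> b \<otimes> s) (s \<otimes> t)"
proof -
  have "fraction R S (a' \<otimes> t' \<oplus> b' \<otimes> s') (s' \<otimes> t') = fraction R S (a \<otimes> t \<oplus> b \<otimes> s) (s \<otimes> t)"
    if carr': "a' \<in> carrier R" "s' \<in> S" "b' \<in> carrier R" "t' \<in> S"
      and eqs: "fraction R S a' s' = fraction R S a s" "fraction R S b' t' = fraction R S b t"
    for a' s' b' t'
  proof -
    obtain u where u: "u \<in> S" "u \<otimes> (a' \<otimes> s) = u \<otimes> (a \<otimes> s')"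
      using eqs(1) fraction_eq_iff[OF carr'(1,2) carr(1,2)] by blast
    obtain v where v: "v \<in> S" "v \<otimes> (b' \<otimes> t) = v \<otimes> (b \<otimes> t')"
      using eqs(2) fraction_eq_iff[OF carr'(3,4) carr(3,4)] by blast
    have "(u \<otimes> v) \<otimes> ((a' \<otimes> t' \<oplus> b' \<otimes> s') \<otimes> (s \<otimes> t)) =
      (u \<otimes> (a' \<otimes> s)) \<otimes> (v \<otimes> (t \<otimes> t')) \<oplus> (v \<otimes> (b' \<otimes> t)) \<otimes> (u \<otimes> (s \<otimes> s'))"
      using carr carr' u(1) v(1) by (simp add: m_ac l_distr r_distr)
    also have "\<dots> = (u \<otimes> v) \<otimes> ((a \<otimes> t \<oplus> b \<otimes> s) \<otimes> (s' \<otimes> t'))"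
      unfolding u v using carr carr' u(1) v(1) by (simp add: m_ac l_distr r_distr)
    finally show ?thesis
      by (rule fraction_eq_witness[rotated]) (use carr carr' u(1) v(1) in simp_all)
  qed
  then have "(\<Union>(a', s')\<in>fraction R S a s. \<Union>(b', t')\<in>fraction R S b t.
      fraction R S (a' \<otimes> t' \<oplus> b' \<otimes> s') (s' \<otimes> t')) =
      fraction R S (a \<otimes> t \<oplus> b \<otimes> s) (s \<otimes> t)"
    by (rule UN_fraction2[OF carr])
  then show ?thesis by (simp add: localization_def)
qed

lemma cring_localization: "cring (localization R S)" (is "cring ?L")
proof (rule cringI)
  note calc = zero_localization one_localization mult_fraction add_fraction
  note ac = m_ac a_ac l_distr r_distr
  show "abelian_group ?L"
  proof (rule abelian_groupI)
    fix X Y Z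
    assume "X \<in> carrier ?L" "Y \<in> carrier ?L" "Z \<in> carrier ?L"
    then obtain a s b t c u where
      "X = fraction R S a s" "a \<in> carrier R" "s \<in> S"
      "Y = fraction R S b t" "b \<in> carrier R" "t \<in> S"
      "Z = fraction R S c u" "c \<in> carrier R" "u \<in> S"
      by (elim localization_cases)
    then show "X \<oplus>\<^bsub>?L\<^esub> Y \<oplus>\<^bsub>?L\<^esub> Z = X \<oplus>\<^bsub>?L\<^esub> (Y \<oplus>\<^bsub>?L\<^esub> Z)"
      by (simp add: add_fraction ac)
  next
    fix X assume "X \<in> carrier ?L"
    then obtain a s where X: "X = fraction R S a s" "a \<in> carrier R" "s \<in> S"
      by (rule localization_cases)
    have "fraction R S (\<ominus> a) s \<oplus>\<^bsub>?L\<^esub> X = \<zero>\<^bsub>?L\<^esub>"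
      using X by (simp add: calc l_minus l_neg fraction_zero[of "s \<otimes> s"])
    then show "\<exists>Y\<in>carrier ?L. Y \<oplus>\<^bsub>?L\<^esub> X = \<zero>\<^bsub>?L\<^esub>" using X by blast
  qed (auto elim!: localization_cases simp: calc ac)
  show "comm_monoid ?L"
    by (rule comm_monoidI) (auto elim!: localization_cases simp: calc m_ac)
  fix X Y Z
  assume "X \<in> carrier ?L" "Y \<in> carrier ?L" "Z \<in> carrier ?L"
  then obtain a s b t c u where
    "X = fraction R S a s" "a \<in> carrier R" "s \<in> S"
    "Y = fraction R S b t" "b \<in> carrier R" "t \<in> S"
    "Z = fraction R S c u" "c \<in> carrier R" "u \<in> S"
    by (elim localization_cases)
  then show "(X \<oplus>\<^bsub>?L\<^esub> Y) \<otimes>\<^bsub>?L\<^esub> Z = X \<otimes>\<^bsub>?L\<^esub> Z \<oplus>\<^bsub>?L\<^esub> Y \<otimes>\<^bsub>?L\<^esub> Z"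
    by (simp add: add_fraction mult_fraction) (rule fraction_eqI; simp add: ac)
qed


section \<open>Prime ideals of the ring of fractions\<close>

text \<open>The fractions \<open>a / s\<close> and \<open>a / 1\<close> differ by the unit \<open>s / 1\<close>, so an ideal of fractions is
  determined by its contraction.\<close>

lemma fraction_mem_ideal_iff:
  assumes Q: "ideal Q (localization R S)" and a: "a \<in> carrier R" and s: "s \<in> S"
  shows "fraction R S a s \<in> Q \<longleftrightarrow> a \<in> contraction R S Q"
proof -
  have 1: "fraction R S a \<one> = fraction R S s \<one> \<otimes>\<^bsub>localization R S\<^esub> fraction R S a s"
    using a s by (simp add: mult_fraction) (rule fraction_eqI; simp add: m_ac)
  have 2: "fraction R S a s = fraction R S \<one> s \<otimes>\<^bsub>localization R S\<^esub> fraction R S a \<one>"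
    using a s by (simp add: mult_fraction)
  have "fraction R S a s \<in> Q \<longleftrightarrow> fraction R S a \<one> \<in> Q"
  proof
    assume "fraction R S a s \<in> Q"
    then show "fraction R S a \<one> \<in> Q"
      unfolding 1 using s by (intro ideal.I_l_closed[OF Q]) simp_all
  next
    assume "fraction R S a \<one> \<in> Q"
    then show "fraction R S a s \<in> Q"
      unfolding 2 using s by (intro ideal.I_l_closed[OF Q]) simp_all
  qed
  then show ?thesis using a by (simp add: contraction_def)
qed

lemma contraction_subset_iff:
  assumes Q: "ideal Q (localization R S)" and Q': "ideal Q' (localization R S)"
  shows "contraction R S Q \<subseteq> contraction R S Q' \<longleftrightarrow> Q \<subseteq> Q'"
proof
  assume sub: "contraction R S Q \<subseteq> contraction R S Q'"
  show "Q \<subseteq> Q'"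
  proof
    fix X assume X: "X \<in> Q"
    then have "X \<in> carrier (localization R S)"
      using additive_subgroup.a_subset[OF ideal.axioms(1)[OF Q]] by blast
    then obtain a s where as: "X = fraction R S a s" "a \<in> carrier R" "s \<in> S"
      by (rule localization_cases)
    then have "a \<in> contraction R S Q"
      using X fraction_mem_ideal_iff[OF Q as(2,3)] by simp
    then have "a \<in> contraction R S Q'" using sub by blast
    then show "X \<in> Q'" using as fraction_mem_ideal_iff[OF Q' as(2,3)] by simp
  qed
qed (auto simp: contraction_def)

lemma disjoint_primesD:
  assumes "P \<in> disjoint_primes R S"
  shows "primeideal P R" and "P \<inter> S = {}"
  using assms by (auto simp: disjoint_primes_def Spec_def)

lemma contraction_in_disjoint_primes:
  assumes "Q \<in> Spec (localization R S)"
  shows "contraction R S Q \<in> disjoint_primes R S"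
proof -
  interpret Q: primeideal Q "localization R S" using assms by (simp add: Spec_def)
  have mult: "fraction R S (a \<otimes> b) \<one> =
      fraction R S a \<one> \<otimes>\<^bsub>localization R S\<^esub> fraction R S b \<one>"
    if "a \<in> carrier R" "b \<in> carrier R" for a b
    using that by (simp add: mult_fraction)
  have disj: "contraction R S Q \<inter> S = {}"
  proof (rule ccontr)
    assume "contraction R S Q \<inter> S \<noteq> {}"
    then obtain s where s: "s \<in> S" "s \<in> contraction R S Q" by blast
    then have "fraction R S s s \<in> Q"
      by (simp add: fraction_mem_ideal_iff Q.is_ideal)
    moreover have "fraction R S s s = \<one>\<^bsub>localization R S\<^esub>"
      using s by (simp add: one_localization fraction_self[of s])
    ultimately have "Q = carrier (localization R S)" by (intro Q.one_imp_carrier) simp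
    then show False using Q.I_notcarr by simp
  qed
  have "primeideal (contraction R S Q) R"
  proof (rule primeidealI)
    show "ideal (contraction R S Q) R"
    proof (rule idealI_of_closed)
      show "\<zero> \<in> contraction R S Q"
        using additive_subgroup.zero_closed[OF Q.is_additive_subgroup]
        unfolding contraction_def zero_localization by blast
    next
      fix a b assume "a \<in> contraction R S Q" "b \<in> contraction R S Q"
      moreover from this have "fraction R S (a \<oplus> b) \<one> =
          fraction R S a \<one> \<oplus>\<^bsub>localization R S\<^esub> fraction R S b \<one>"
        by (simp add: add_fraction contraction_def)
      ultimately show "a \<oplus> b \<in> contraction R S Q"
        using additive_subgroup.a_closed[OF Q.is_additive_subgroup]
        by (simp add: contraction_def)
    next
      fix a x assume "a \<in> contraction R S Q" "x \<in> carrier R"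
      then show "x \<otimes> a \<in> contraction R S Q"
        using Q.I_l_closed mult by (simp add: contraction_def)
    qed (auto simp: contraction_def)
    show "cring R" by (rule is_cring)
    show "carrier R \<noteq> contraction R S Q" using disj one_in_S by blast
    show "a \<in> contraction R S Q \<or> b \<in> contraction R S Q"
      if "a \<in> carrier R" "b \<in> carrier R" "a \<otimes> b \<in> contraction R S Q" for a b
      using that Q.I_prime mult by (simp add: contraction_def)
  qed
  then show ?thesis using disj by (simp add: disjoint_primes_def Spec_def)
qed

lemma disjoint_prime_cancel:
  assumes "P \<in> disjoint_primes R S" and "s \<in> S" and "a \<in> carrier R" and "s \<otimes> a \<in> P"
  shows "a \<in> P"
proof -
  have "s \<in> P \<or> a \<in> P"
    using disjoint_primesD(1)[OF assms(1)] assms(2-4) by (intro primeideal.I_prime) simp_all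
  moreover have "s \<notin> P" using disjoint_primesD(2)[OF assms(1)] assms(2) by auto
  ultimately show ?thesis by simp
qed

definition extension :: "'a set \<Rightarrow> ('a \<times> 'a) set set" where
  "extension P = {fraction R S a s | a s. a \<in> P \<and> s \<in> S}"

lemma extension_cases:
  assumes "X \<in> extension P"
  obtains a s where "X = fraction R S a s" "a \<in> P" "s \<in> S"
  using assms unfolding extension_def by blast

text \<open>The representatives of a fraction are not unique, but an equation
  \<open>u \<otimes> (a \<otimes> t) = u \<otimes> (b \<otimes> s)\<close> with \<open>b \<in> P\<close> still forces \<open>a \<in> P\<close>, since \<open>P\<close> is
  prime and contains neither \<open>u\<close> nor \<open>t\<close>. So the contraction of the extension is \<open>P\<close>, and the
  ideal properties of the extension can be read off from numerators.\<close>

lemma fraction_mem_extension_iff: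
  assumes P: "P \<in> disjoint_primes R S" and a: "a \<in> carrier R" and s: "s \<in> S"
  shows "fraction R S a s \<in> extension P \<longleftrightarrow> a \<in> P"
proof
  interpret P: primeideal P R using P by (rule disjoint_primesD)
  assume "fraction R S a s \<in> extension P"
  then obtain b t where b: "b \<in> P" "t \<in> S" and eq: "fraction R S a s = fraction R S b t"
    by (rule extension_cases)
  have b_carr: "b \<in> carrier R" using b(1) P.a_subset by blast
  obtain u where u: "u \<in> S" "u \<otimes> (a \<otimes> t) = u \<otimes> (b \<otimes> s)"
    using eq fraction_eq_iff[OF a s b_carr b(2)] by blast
  have "(u \<otimes> t) \<otimes> a = u \<otimes> (b \<otimes> s)"
    using a s b(2) b_carr u by (simp add: m_assoc m_comm[of t a])
  then have "(u \<otimes> t) \<otimes> a \<in> P"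
    using b s u by (simp add: P.I_l_closed P.I_r_closed)
  then show "a \<in> P" using disjoint_prime_cancel[OF P _ a, of "u \<otimes> t"] u b by simp
next
  assume "a \<in> P"
  then show "fraction R S a s \<in> extension P" unfolding extension_def using s by blast
qed

lemma extension_in_Spec:
  assumes P: "P \<in> disjoint_primes R S"
  shows "extension P \<in> Spec (localization R S)"
proof -
  interpret P: primeideal P R using P by (rule disjoint_primesD)
  interpret L: cring "localization R S" by (rule cring_localization)
  note mem = fraction_mem_extension_iff[OF P]
  have sub: "extension P \<subseteq> carrier (localization R S)"
  proof
    fix X assume "X \<in> extension P"
    then obtain a s where "X = fraction R S a s" "a \<in> P" "s \<in> S"
      by (rule extension_cases)
    then show "X \<in> carrier (localization R S)" using P.a_subset by auto
  qed
  have "primeideal (extension P) (localization R S)"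
  proof (rule primeidealI)
    show "ideal (extension P) (localization R S)"
    proof (rule L.idealI_of_closed[OF sub])
      show "\<zero>\<^bsub>localization R S\<^esub> \<in> extension P"
        by (simp add: zero_localization mem)
    next
      fix X Y assume "X \<in> extension P" "Y \<in> extension P"
      then obtain a s b t where "X = fraction R S a s" "a \<in> P" "s \<in> S"
        "Y = fraction R S b t" "b \<in> P" "t \<in> S"
        by (elim extension_cases)
      then show "X \<oplus>\<^bsub>localization R S\<^esub> Y \<in> extension P"
        by (simp add: add_fraction mem P.I_r_closed P.Icarr)
    next
      fix X Y assume "X \<in> extension P" "Y \<in> carrier (localization R S)"
      then obtain a s b t where "X = fraction R S a s" "a \<in> P" "s \<in> S"
        "Y = fraction R S b t" "b \<in> carrier R" "t \<in> S"
        by (elim extension_cases localization_cases)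
      then show "Y \<otimes>\<^bsub>localization R S\<^esub> X \<in> extension P"
        by (simp add: mult_fraction mem P.I_l_closed P.Icarr)
    qed
    show "cring (localization R S)" by (rule cring_localization)
    have "\<one> \<notin> P" using disjoint_primesD(2)[OF P] one_in_S by blast
    then have "fraction R S \<one> \<one> \<notin> extension P" by (simp add: mem)
    then show "carrier (localization R S) \<noteq> extension P"
      using fraction_in_carrier[OF one_closed one_in_S] by metis
    fix X Y
    assume XY: "X \<in> carrier (localization R S)" "Y \<in> carrier (localization R S)"
      "X \<otimes>\<^bsub>localization R S\<^esub> Y \<in> extension P"
    from XY(1,2) obtain a s b t where "X = fraction R S a s" "a \<in> carrier R" "s \<in> S"
      "Y = fraction R S b t" "b \<in> carrier R" "t \<in> S"
      by (elim localization_cases)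
    then show "X \<in> extension P \<or> Y \<in> extension P"
      using XY(3) P.I_prime by (simp add: mult_fraction mem)
  qed
  then show ?thesis by (simp add: Spec_def)
qed

lemma bij_betw_contraction:
  "bij_betw (contraction R S) (Spec (localization R S)) (disjoint_primes R S)"
proof (rule bij_betw_imageI)
  show "inj_on (contraction R S) (Spec (localization R S))"
  proof (rule inj_onI)
    fix Q Q' assume "Q \<in> Spec (localization R S)" "Q' \<in> Spec (localization R S)"
      and eq: "contraction R S Q = contraction R S Q'"
    then have "ideal Q (localization R S)" "ideal Q' (localization R S)"
      by (auto simp: Spec_def intro: primeideal.axioms(1))
    then show "Q = Q'"
      using eq contraction_subset_iff[of Q Q'] contraction_subset_iff[of Q' Q] by simp
  qed
  have "P \<in> contraction R S ` Spec (localization R S)" if P: "P \<in> disjoint_primes R S" for P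
  proof
    interpret P: primeideal P R using P by (rule disjoint_primesD)
    show "extension P \<in> Spec (localization R S)" using P by (rule extension_in_Spec)
    show "P = contraction R S (extension P)"
      using P.a_subset by (auto simp: contraction_def fraction_mem_extension_iff[OF P])
  qed
  then show "contraction R S ` Spec (localization R S) = disjoint_primes R S"
    using contraction_in_disjoint_primes by blast
qed


section \<open>The saturation of an \<open>S\<close>-prime ideal\<close>

definition saturation :: "'a set \<Rightarrow> 'a set" where
  "saturation P = {f \<in> carrier R. \<exists>s\<in>S. s \<otimes> f \<in> P}"

lemma S_V_eq:
  "f \<in> carrier R \<Longrightarrow> S_V R S f = {P \<in> S_Spec R S. f \<in> saturation P}"
  by (auto simp: S_V_def saturation_def)

text \<open>Saturating absorbs the element \<open>s\<close> that weakens primeness to \<open>S\<close>-primeness, so the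
  result is prime in the ordinary sense.\<close>

lemma saturation_in_disjoint_primes:
  assumes P: "P \<in> S_Spec R S"
  shows "saturation P \<in> disjoint_primes R S"
proof -
  have "ideal P R" and disjP: "P \<inter> S = {}"
    using P by (auto simp: S_Spec_def S_prime_def)
  obtain s where s: "s \<in> S" and Sprime: "\<And>a b. \<lbrakk>a \<in> carrier R; b \<in> carrier R; a \<otimes> b \<in> P\<rbrakk>
      \<Longrightarrow> s \<otimes> a \<in> P \<or> s \<otimes> b \<in> P"
    using P by (auto simp: S_Spec_def S_prime_def)
  interpret P: ideal P R by fact
  have disj: "saturation P \<inter> S = {}"
    using disjP S_mult by (auto simp: saturation_def)
  have "primeideal (saturation P) R"
  proof (rule primeidealI)
    show "ideal (saturation P) R"
    proof (rule idealI_of_closed)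
      show "\<zero> \<in> saturation P" by (auto simp: saturation_def)
    next
      fix f g assume "f \<in> saturation P" "g \<in> saturation P"
      then obtain u v where carr: "f \<in> carrier R" "g \<in> carrier R" "u \<in> S" "v \<in> S"
        and mem: "u \<otimes> f \<in> P" "v \<otimes> g \<in> P"
        by (auto simp: saturation_def)
      have "(u \<otimes> v) \<otimes> (f \<oplus> g) = v \<otimes> (u \<otimes> f) \<oplus> u \<otimes> (v \<otimes> g)"
        using carr by (simp add: r_distr m_ac)
      also have "\<dots> \<in> P" using carr mem by (simp add: P.I_l_closed)
      finally show "f \<oplus> g \<in> saturation P" using carr by (auto simp: saturation_def)
    next
      fix f x assume "f \<in> saturation P" and x: "x \<in> carrier R"
      then obtain u where f: "f \<in> carrier R" "u \<in> S" "u \<otimes> f \<in> P"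
        by (auto simp: saturation_def)
      have "u \<otimes> (x \<otimes> f) = x \<otimes> (u \<otimes> f)" using f x by (simp add: m_ac)
      also have "\<dots> \<in> P" using f x by (simp add: P.I_l_closed)
      finally show "x \<otimes> f \<in> saturation P" using f x by (auto simp: saturation_def)
    qed (auto simp: saturation_def)
    show "cring R" by (rule is_cring)
    show "carrier R \<noteq> saturation P" using disj one_in_S by blast
    fix f g assume carr: "f \<in> carrier R" "g \<in> carrier R" and "f \<otimes> g \<in> saturation P"
    then obtain u where u: "u \<in> S" "u \<otimes> (f \<otimes> g) \<in> P" by (auto simp: saturation_def)
    have "(u \<otimes> f) \<otimes> g \<in> P" using carr u by (simp add: m_assoc)
    then have "s \<otimes> (u \<otimes> f) \<in> P \<or> s \<otimes> g \<in> P" using carr u by (intro Sprime) auto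
    moreover have "s \<otimes> (u \<otimes> f) = (s \<otimes> u) \<otimes> f" using carr u s by (simp add: m_assoc)
    ultimately show "f \<in> saturation P \<or> g \<in> saturation P"
      using carr s u(1) S_mult[OF s u(1)] unfolding saturation_def by force
  qed
  then show ?thesis using disj by (simp add: disjoint_primes_def Spec_def)
qed

lemma disjoint_primes_subset_S_Spec: "disjoint_primes R S \<subseteq> S_Spec R S"
proof
  fix P assume P: "P \<in> disjoint_primes R S"
  interpret P: primeideal P R using P by (rule disjoint_primesD)
  have "\<forall>a\<in>carrier R. \<forall>b\<in>carrier R. a \<otimes> b \<in> P \<longrightarrow> \<one> \<otimes> a \<in> P \<or> \<one> \<otimes> b \<in> P"
    using P.I_prime by simp
  then have "S_prime R S P"
    unfolding S_prime_def using disjoint_primesD(2)[OF P] P.is_ideal one_in_S by blast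
  then show "P \<in> S_Spec R S" by (simp add: S_Spec_def)
qed

lemma saturation_disjoint_prime:
  assumes P: "P \<in> disjoint_primes R S"
  shows "saturation P = P"
proof -
  interpret P: primeideal P R using P by (rule disjoint_primesD)
  show ?thesis
  proof
    show "saturation P \<subseteq> P" using disjoint_prime_cancel[OF P] by (auto simp: saturation_def)
    show "P \<subseteq> saturation P"
      using P.a_subset one_in_S by (force simp: saturation_def)
  qed
qed


section \<open>The \<open>S\<close>-flat topology\<close>

lemma zero_in_saturation: "P \<in> S_Spec R S \<Longrightarrow> \<zero> \<in> saturation P"
  using disjoint_primesD(1)[OF saturation_in_disjoint_primes]
  by (meson additive_subgroup.zero_closed ideal_def primeideal_def)

lemma topspace_S_flat: "topspace (S_flat R S) = S_Spec R S"
proof -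
  have "S_V R S \<zero> = S_Spec R S" using zero_in_saturation by (auto simp: S_V_eq)
  moreover have "S_V R S f \<subseteq> S_Spec R S" for f unfolding S_V_def by blast
  ultimately show ?thesis
    unfolding S_flat_def topology_generated_by_topspace using zero_closed by blast
qed

lemma openin_S_V: "f \<in> carrier R \<Longrightarrow> openin (S_flat R S) (S_V R S f)"
  unfolding S_flat_def by (rule topology_generated_by_Basis) blast

text \<open>Induction over the generation of open sets replaces an explicit description of them by
  unions of finite intersections of the \<open>V(f)\<close>.\<close>

lemma S_flat_open_induct [consumes 1, case_names Int Un Basis]:
  assumes "openin (S_flat R S) U"
    and "\<And>U V. openin (S_flat R S) U \<Longrightarrow> openin (S_flat R S) V \<Longrightarrow> Pr U \<Longrightarrow> Pr V \<Longrightarrow> Pr (U \<inter> V)"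
    and "\<And>K. (\<And>U. U \<in> K \<Longrightarrow> openin (S_flat R S) U) \<Longrightarrow> (\<And>U. U \<in> K \<Longrightarrow> Pr U) \<Longrightarrow> Pr (\<Union>K)"
    and "\<And>f. f \<in> carrier R \<Longrightarrow> Pr (S_V R S f)"
  shows "Pr U"
proof -
  have "generate_topology_on (S_V R S ` carrier R) U"
    using assms(1) by (simp add: S_flat_def openin_topology_generated_by_iff)
  then show ?thesis
  proof induction
    case Empty
    then show ?case using assms(3)[of "{}"] by simp
  next
    case (Int a b)
    then show ?case
      using assms(2) by (simp add: S_flat_def openin_topology_generated_by_iff)
  next
    case (UN K)
    then show ?case
      using assms(3) by (simp add: S_flat_def openin_topology_generated_by_iff)
  next
    case (Basis s)
    then show ?case using assms(4) by blast
  qed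
qed

lemma S_flat_open_generalization:
  assumes "openin (S_flat R S) U" and "P \<in> S_Spec R S"
    and "saturation Q \<subseteq> saturation P" and "Q \<in> U"
  shows "P \<in> U"
  using assms by (induction rule: S_flat_open_induct) (auto simp: S_V_eq)

text \<open>\<open>Q\<close> is in the closure of \<open>P\<close> iff each open set containing \<open>Q\<close> contains \<open>P\<close>. For
  the sub-basic sets \<open>V(f)\<close> this says that the saturation of \<open>Q\<close> lies in that of \<open>P\<close>, and by
  \<open>S_flat_open_generalization\<close> they decide the matter.\<close>

lemma Lambda_eq:
  assumes P: "P \<in> S_Spec R S"
  shows "Lambda R S P = {Q \<in> S_Spec R S. saturation Q \<subseteq> saturation P}"
proof
  show "Lambda R S P \<subseteq> {Q \<in> S_Spec R S. saturation Q \<subseteq> saturation P}"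
  proof
    fix Q assume "Q \<in> Lambda R S P"
    then have Q: "Q \<in> S_Spec R S"
      and meets: "\<And>U. openin (S_flat R S) U \<Longrightarrow> Q \<in> U \<Longrightarrow> P \<in> U"
      by (auto simp: Lambda_def in_closure_of topspace_S_flat)
    have "f \<in> saturation P" if f: "f \<in> saturation Q" for f
    proof -
      have carr: "f \<in> carrier R" using f by (simp add: saturation_def)
      then have "Q \<in> S_V R S f" using Q f by (simp add: S_V_eq)
      then have "P \<in> S_V R S f" using meets openin_S_V[OF carr] by blast
      then show ?thesis using carr by (simp add: S_V_eq)
    qed
    then show "Q \<in> {Q \<in> S_Spec R S. saturation Q \<subseteq> saturation P}" using Q by blast
  qed
  show "{Q \<in> S_Spec R S. saturation Q \<subseteq> saturation P} \<subseteq> Lambda R S P"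
    using S_flat_open_generalization[OF _ P]
    by (auto simp: Lambda_def in_closure_of topspace_S_flat)
qed

lemma Lambda_subset_iff:
  assumes P: "P \<in> disjoint_primes R S" and P': "P' \<in> disjoint_primes R S"
  shows "Lambda R S P \<subseteq> Lambda R S P' \<longleftrightarrow> P \<subseteq> P'"
  using assms disjoint_primes_subset_S_Spec
  by (auto simp: Lambda_eq subset_iff saturation_disjoint_prime)

text \<open>Only closure under addition is a problem for a union of prime ideals. For \<open>f\<close> and \<open>g\<close> in
  the union, the open sets \<open>V(f)\<close> and \<open>V(g)\<close> meet \<open>Z\<close>, hence have a common point
  in \<open>Z\<close>, whose saturation contains \<open>f\<close> and \<open>g\<close> together.\<close>

lemma generic_prime_of_irreducible:
  assumes irr: "irreducible_in (S_flat R S) Z"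
  shows "(\<Union>Q\<in>Z. saturation Q) \<in> disjoint_primes R S"
proof -
  have Z: "Z \<subseteq> S_Spec R S" and nonempty: "Z \<noteq> {}"
    using irr by (auto simp: irreducible_in_def topspace_S_flat)
  have sat: "primeideal (saturation Q) R" "saturation Q \<inter> S = {}" if "Q \<in> Z" for Q
    using disjoint_primesD[OF saturation_in_disjoint_primes] Z that by blast+
  have carr: "saturation Q \<subseteq> carrier R" for Q by (auto simp: saturation_def)
  have disj: "(\<Union>Q\<in>Z. saturation Q) \<inter> S = {}" using sat(2) by blast
  have "primeideal (\<Union>Q\<in>Z. saturation Q) R"
  proof (rule primeidealI)
    show "ideal (\<Union>Q\<in>Z. saturation Q) R"
    proof (rule idealI_of_closed)
      show "(\<Union>Q\<in>Z. saturation Q) \<subseteq> carrier R" using carr by blast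
      show "\<zero> \<in> (\<Union>Q\<in>Z. saturation Q)" using nonempty Z zero_in_saturation by blast
    next
      fix f g assume fg: "f \<in> (\<Union>Q\<in>Z. saturation Q)" "g \<in> (\<Union>Q\<in>Z. saturation Q)"
      then have c: "f \<in> carrier R" "g \<in> carrier R" using carr by blast+
      have "Z \<inter> (S_V R S f \<inter> S_V R S g) \<noteq> {}"
      proof (rule irreducible_in_open_Int_nonempty[OF irr openin_S_V openin_S_V])
        show "Z \<inter> S_V R S f \<noteq> {}" "Z \<inter> S_V R S g \<noteq> {}"
          using fg Z c by (auto simp: S_V_eq)
      qed (use c in auto)
      then obtain Q where Q: "Q \<in> Z" "f \<in> saturation Q" "g \<in> saturation Q"
        using c by (auto simp: S_V_eq)
      interpret Q: primeideal "saturation Q" R using sat(1) Q(1) .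
      show "f \<oplus> g \<in> (\<Union>Q\<in>Z. saturation Q)" using Q Q.a_closed by blast
    next
      fix f x assume "f \<in> (\<Union>Q\<in>Z. saturation Q)" and x: "x \<in> carrier R"
      then obtain Q where Q: "Q \<in> Z" "f \<in> saturation Q" by blast
      interpret Q: primeideal "saturation Q" R using sat(1) Q(1) .
      show "x \<otimes> f \<in> (\<Union>Q\<in>Z. saturation Q)" using Q Q.I_l_closed x by blast
    qed
    show "cring R" by (rule is_cring)
    show "carrier R \<noteq> (\<Union>Q\<in>Z. saturation Q)" using disj one_in_S by blast
    fix f g assume c: "f \<in> carrier R" "g \<in> carrier R" and "f \<otimes> g \<in> (\<Union>Q\<in>Z. saturation Q)"
    then obtain Q where Q: "Q \<in> Z" "f \<otimes> g \<in> saturation Q" by blast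
    interpret Q: primeideal "saturation Q" R using sat(1) Q(1) .
    show "f \<in> (\<Union>Q\<in>Z. saturation Q) \<or> g \<in> (\<Union>Q\<in>Z. saturation Q)"
      using Q.I_prime[OF c Q(2)] Q(1) by blast
  qed
  then show ?thesis using disj by (simp add: disjoint_primes_def Spec_def)
qed

text \<open>It suffices that every open neighbourhood of the generic prime meets \<open>Z\<close>. For a sub-basic
  \<open>V(f)\<close> this is how the generic prime is defined, and irreducibility carries the property over to
  intersections.\<close>

lemma generic_prime_mem_closed:
  assumes irr: "irreducible_in (S_flat R S) Z" and closed: "closedin (S_flat R S) Z"
  shows "(\<Union>Q\<in>Z. saturation Q) \<in> Z" (is "?p \<in> Z")
proof -
  have Z: "Z \<subseteq> S_Spec R S" using irr by (simp add: irreducible_in_def topspace_S_flat)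
  have p: "?p \<in> disjoint_primes R S" using irr by (rule generic_prime_of_irreducible)
  have "Z \<inter> U \<noteq> {}" if "openin (S_flat R S) U" "?p \<in> U" for U
    using that
  proof (induction rule: S_flat_open_induct)
    case (Int U V)
    then show ?case using irreducible_in_open_Int_nonempty[OF irr] by blast
  next
    case (Un K)
    then show ?case by blast
  next
    case (Basis f)
    then have "f \<in> ?p" using saturation_disjoint_prime[OF p] by (simp add: S_V_eq)
    then show ?case using Z Basis by (auto simp: S_V_eq)
  qed
  then have "?p \<in> S_flat R S closure_of Z"
    using p disjoint_primes_subset_S_Spec by (auto simp: in_closure_of topspace_S_flat)
  then show ?thesis using closed by (simp add: closure_of_closedin)
qed

lemma bij_betw_Lambda:
  "bij_betw (Lambda R S) (disjoint_primes R S) (irreducible_closed (S_flat R S))"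
proof (rule bij_betw_imageI)
  show "inj_on (Lambda R S) (disjoint_primes R S)"
    by (rule inj_onI) (metis Lambda_subset_iff subset_antisym subset_refl)
  have "Lambda R S P \<in> irreducible_closed (S_flat R S)" if "P \<in> disjoint_primes R S" for P
    using that disjoint_primes_subset_S_Spec
    by (auto simp: Lambda_def irreducible_closed_def topspace_S_flat
        intro!: irreducible_in_closure_of_point)
  moreover have "Z \<in> Lambda R S ` disjoint_primes R S"
    if "Z \<in> irreducible_closed (S_flat R S)" for Z
  proof
    let ?p = "\<Union>Q\<in>Z. saturation Q"
    have irr: "irreducible_in (S_flat R S) Z" and closed: "closedin (S_flat R S) Z"
      using that by (auto simp: irreducible_closed_def)
    show p: "?p \<in> disjoint_primes R S" using irr by (rule generic_prime_of_irreducible)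
    show "Z = Lambda R S ?p"
    proof
      show "Z \<subseteq> Lambda R S ?p"
      proof -
        have "Z \<subseteq> S_Spec R S" using irr by (simp add: irreducible_in_def topspace_S_flat)
        moreover have "Lambda R S ?p = {Q \<in> S_Spec R S. saturation Q \<subseteq> ?p}"
          using p disjoint_primes_subset_S_Spec saturation_disjoint_prime[OF p]
          by (subst Lambda_eq) auto
        ultimately show ?thesis by auto
      qed
      show "Lambda R S ?p \<subseteq> Z"
        unfolding Lambda_def using generic_prime_mem_closed[OF irr closed] closed
        by (simp add: closure_of_minimal)
    qed
  qed
  ultimately show "Lambda R S ` disjoint_primes R S = irreducible_closed (S_flat R S)" by blast
qed

lemma bij_betw_Max_Spec_irreducible_components:
  "bij_betw (\<lambda>M. Lambda R S (contraction R S M)) (Max_Spec (localization R S))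
    (irreducible_components (S_flat R S))"
proof -
  let ?L = "localization R S" and ?F = "\<lambda>M. Lambda R S (contraction R S M)"
  interpret L: cring ?L by (rule cring_localization)
  have bij: "bij_betw ?F (Spec ?L) (irreducible_closed (S_flat R S))"
    using bij_betw_trans[OF bij_betw_contraction bij_betw_Lambda] by (simp add: comp_def)
  have mono: "?F M \<subseteq> ?F N \<longleftrightarrow> M \<subseteq> N" if "M \<in> Spec ?L" "N \<in> Spec ?L" for M N
    using that contraction_in_disjoint_primes
    by (simp add: Lambda_subset_iff contraction_subset_iff Spec_def primeideal.axioms(1))
  have inj: "inj_on ?F (Spec ?L)" and img: "irreducible_closed (S_flat R S) = ?F ` Spec ?L"
    using bij by (auto simp: bij_betw_def)
  have max: "?F M \<in> irreducible_components (S_flat R S) \<longleftrightarrow> M \<in> Max_Spec ?L"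
    if M: "M \<in> Spec ?L" for M
    using M mono inj_on_eq_iff[OF inj]
    by (auto simp: irreducible_components_iff_maximal_closed L.Max_Spec_iff_maximal_in_Spec img)
  have "Max_Spec ?L \<subseteq> Spec ?L"
    using L.Max_Spec_iff_maximal_in_Spec by blast
  moreover have "?F ` Max_Spec ?L = irreducible_components (S_flat R S)"
  proof
    show "?F ` Max_Spec ?L \<subseteq> irreducible_components (S_flat R S)"
      using max \<open>Max_Spec ?L \<subseteq> Spec ?L\<close> by blast
    show "irreducible_components (S_flat R S) \<subseteq> ?F ` Max_Spec ?L"
    proof
      fix Z assume Z: "Z \<in> irreducible_components (S_flat R S)"
      then have "Z \<in> ?F ` Spec ?L"
        using irreducible_components_iff_maximal_closed img by blast
      then show "Z \<in> ?F ` Max_Spec ?L" using max Z by blast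
    qed
  qed
  ultimately show ?thesis
    using bij_betw_subset[OF bij] by blast
qed

end

theorem proposition4p8:
  fixes R :: "('a, 'm) ring_scheme" and S :: "'a set"
  assumes "cring R" and "\<one>\<^bsub>R\<^esub> \<noteq> \<zero>\<^bsub>R\<^esub>" and "mult_closed R S"
  shows "bij_betw (contraction R S) (Spec (localization R S)) (disjoint_primes R S) \<and>
    bij_betw (Lambda R S) (disjoint_primes R S) (irreducible_closed (S_flat R S)) \<and>
    bij_betw (\<lambda>M. Lambda R S (contraction R S M)) (Max_Spec (localization R S))
      (irreducible_components (S_flat R S))"
proof -
  interpret cring_mult_closed R S
    using assms(1,3) by (simp add: cring_mult_closed.intro cring_mult_closed_axioms.intro)
  show ?thesis
    using bij_betw_contraction bij_betw_Lambda bij_betw_Max_Spec_irreducible_components by blast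
qed

end
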